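(* Let $(B,+,\circ)$ be a compact skew left brace. Then $\mathrm{Pb}(B)>\frac{5}{8}$ if and only if $|B/\mathrm{Ann}(B)|\leqslant 2$. Moreover, $|B/\mathrm{Ann}(B)|=2$ if and only if $\mathrm{Pb}(B)=\frac{3}{4}$.
   Context: A skew left brace is a set $B$ with two group structures $(B,+)$ and $(B,\circ)$ (neither assumed abelian) such that $a\circ(b+c)=(a\circ b)-a+(a\circ c)$ for all $a,b,c\in B$, where $-a$ is the inverse of $a$ in $(B,+)$. The identities of the two groups coincide and are denoted by $1$. A topological skew left brace is a skew left brace equipped with one topology for which both $(B,+)$ and $(B,\circ)$ are topological groups. "Compact skew left brace" means a topological skew left brace whose topology is compact and Hausdorff. Put $a*b:=-a+(a\circ b)-b$ and $[a,b]^+:=a+b-a-b$. The annihilator of $B$ is $\mathrm{Ann}(B):=\{a\in B\mid a+b=b+a=a\circ b=b\circ a \text{ for all } b\in B\}$, an ideal of $B$. Let $\mu$ be the unique probability Haar measure on $(B,+)$ (it is also the probability Haar measure on $(B,\circ)$), and let $Z:=\{(a,b)\in B\times B\mid a*b=b*a=[a,b]^+=1\}$, a closed subset of $B\times B$. The commuting probability is $\mathrm{Pb}(B):=(\mu\times\mu)(Z)$. *)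

theory Defs
  imports "HOL-Probability.Probability"
begin

section \<open>Skew left braces\<close>

text \<open>The additive group is not assumed abelian (\<open>group_add\<close>). The group \<open>(B, \<circ>)\<close> is given its own
  identity \<open>circ_one\<close>; that it coincides with the additive identity \<open>0\<close> (playing the role of
  \<open>1\<close>) is a consequence of the axioms, see \<open>circ_one_eq_0\<close>.\<close>

class skew_left_brace = group_add +
  fixes circ :: "'a \<Rightarrow> 'a \<Rightarrow> 'a"  (infixl "\<odot>" 70)
    and circ_one :: 'a
    and circ_inverse :: "'a \<Rightarrow> 'a"
  assumes circ_group: "Groups.group (\<odot>) circ_one circ_inverse"
    and circ_add: "a \<odot> (b + c) = (a \<odot> b) - a + (a \<odot> c)"

lemma circ_one_eq_0: "(circ_one :: 'a::skew_left_brace) = 0"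
proof -
  interpret circ: Groups.group "(\<odot>) :: 'a \<Rightarrow> 'a \<Rightarrow> 'a" circ_one circ_inverse
    by (rule circ_group)
  have "circ_one \<odot> (0 + 0) = (circ_one \<odot> 0) - circ_one + (circ_one \<odot> (0::'a))"
    by (rule circ_add)
  then show ?thesis
    by simp
qed

definition brace_star :: "'a::skew_left_brace \<Rightarrow> 'a \<Rightarrow> 'a" where
  "brace_star a b = - a + (a \<odot> b) - b"

definition add_commutator :: "'a::group_add \<Rightarrow> 'a \<Rightarrow> 'a" where
  "add_commutator a b = a + b - a - b"

definition annihilator :: "'a::skew_left_brace set" where
  "annihilator = {a. \<forall>b. a + b = b + a \<and> b + a = a \<odot> b \<and> a \<odot> b = b \<odot> a}"

text \<open>The underlying set of \<open>B / Ann(B)\<close>, as additive cosets.\<close>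

definition annihilator_quotient :: "'a::skew_left_brace set set" where
  "annihilator_quotient = range (\<lambda>a. (\<lambda>z. a + z) ` annihilator)"

definition commuting_pairs :: "('a::skew_left_brace \<times> 'a) set" where
  "commuting_pairs =
    {(a, b). brace_star a b = 0 \<and> brace_star b a = 0 \<and> add_commutator a b = 0}"


section \<open>Topological and compact skew left braces\<close>

class topological_skew_left_brace = skew_left_brace + topological_group_add +
  assumes tendsto_circ_nhds:
      "filterlim (\<lambda>x. fst x \<odot> snd x) (nhds (a \<odot> b)) (nhds a \<times>\<^sub>F nhds b)"
    and tendsto_circ_inverse_nhds: "filterlim circ_inverse (nhds (circ_inverse a)) (nhds a)"

class compact_skew_left_brace = topological_skew_left_brace + t2_space +
  assumes compact_UNIV_brace: "compact UNIV"


section \<open>Haar measure and product measure\<close>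

text \<open>Finite on compact sets, outer regular on Borel sets, inner regular on open sets. The conditions
  \<open>K \<in> sets borel\<close> only matter for non-Hausdorff spaces, whose compact sets need not be Borel.\<close>

definition radon_measure :: "'a::topological_space measure \<Rightarrow> bool" where
  "radon_measure M \<longleftrightarrow>
     sets M = sets borel \<and>
     (\<forall>K. compact K \<longrightarrow> K \<in> sets borel \<longrightarrow> emeasure M K < \<infinity>) \<and>
     (\<forall>A\<in>sets borel. emeasure M A = (INF U\<in>{U. open U \<and> A \<subseteq> U}. emeasure M U)) \<and>
     (\<forall>U. open U \<longrightarrow>
        emeasure M U = (SUP K\<in>{K. compact K \<and> K \<in> sets borel \<and> K \<subseteq> U}. emeasure M K))"

definition haar_probability :: "'a::topological_group_add measure \<Rightarrow> bool" where
  "haar_probability M \<longleftrightarrow>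
     radon_measure M \<and> prob_space M \<and>
     (\<forall>a. \<forall>A\<in>sets borel. emeasure M ((\<lambda>x. a + x) ` A) = emeasure M A)"

text \<open>The topology of \<open>B\<close> need not have a countable base, so the \<open>\<sigma>\<close>-algebra of
  \<open>M \<Otimes>\<^sub>M N\<close>, generated by Borel rectangles, can be strictly smaller than the Borel
  \<open>\<sigma>\<close>-algebra of the product space and need not contain a given closed set (which
  \<open>emeasure\<close> would then send to 0). The product of Radon measures is therefore the (unique) Radon
  measure on the product space that has the product value on Borel rectangles.\<close>

definition is_radon_product ::
  "'a::topological_space measure \<Rightarrow> 'b::topological_space measure \<Rightarrow> ('a \<times> 'b) measure \<Rightarrow> bool" where
  "is_radon_product M N P \<longleftrightarrow>
     radon_measure P \<and>
     (\<forall>A\<in>sets borel. \<forall>B\<in>sets borel. emeasure P (A \<times> B) = emeasure M A * emeasure N B)"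

text \<open>To be used with \<open>P\<close> the Radon product of the Haar probability measure with itself.\<close>

definition commuting_probability :: "('a::skew_left_brace \<times> 'a) measure \<Rightarrow> real" where
  "commuting_probability P = measure P commuting_pairs"

end

theory Submission
  imports Defs
begin

text \<open>
  For \<open>a\<close> in \<open>B\<close> let \<open>C(a)\<close> be the set of all \<open>b\<close> with \<open>a + b = b + a = a \<circ> b = b \<circ> a\<close>. It is the
  slice over \<open>a\<close> of the set \<open>Z\<close> of commuting pairs, and \<open>Ann(B)\<close> is the intersection of all
  \<open>C(a)\<close>, so \<open>C(a) = B\<close> exactly for \<open>a\<close> in \<open>Ann(B)\<close>. Everything rests on the fact that \<open>C(a)\<close>
  has measure at most \<open>1/2\<close> for every other \<open>a\<close> (\<open>centralizer_le_half\<close>).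

  There is no evident reason for \<open>C(a)\<close> to be closed under \<open>+\<close>, but it is a subgroup of
  \<open>(B, \<circ>)\<close> (\<open>circ_in_centralizer\<close>, \<open>circ_inverse_in_centralizer\<close>). A proper subgroup is disjoint
  from one of its translates, so the bound follows once \<open>\<mu>\<close>, which is invariant under additive
  translations, is known to behave well under \<open>\<circ>\<close>-translations. Since \<open>c \<circ> b = c + \<lambda>\<^sub>c(b)\<close> with
  \<open>\<lambda>\<^sub>c\<close> a continuous automorphism of \<open>(B, +)\<close>, what is needed is that
  \<open>\<mu>(K) \<le> \<mu>(\<phi>\<^sup>-\<^sup>1(K))\<close> for such an automorphism \<open>\<phi>\<close> and closed \<open>K\<close>. This is a piece of the
  uniqueness of Haar measure: the set of all \<open>(x, y)\<close> with \<open>- \<phi>(y) + x\<close> in \<open>K\<close> has slices of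
  constant measure in both directions, and comparing the two constants gives \<open>haar_le_vimage\<close>.

  Let \<open>m = \<mu>(Ann(B))\<close>. If \<open>B / Ann(B)\<close> is finite of order \<open>n\<close>, then \<open>m = 1/n\<close>; otherwise
  \<open>m = 0\<close>. Bounding the slices of \<open>Z\<close> by \<open>1\<close> over \<open>Ann(B)\<close> and by \<open>1/2\<close> elsewhere gives
  \<open>Pb(B) \<le> 1/2 + m/2\<close>, which is at most \<open>5/8\<close> unless \<open>n \<le> 3\<close>. Suppose \<open>n \<le> 3\<close>, and let \<open>a\<close>
  lie outside \<open>Ann(B)\<close>. Then \<open>C(a)\<close> contains \<open>Ann(B)\<close> and is a union of its cosets, but two
  cosets would have measure at least \<open>2/3\<close>, against the bound \<open>1/2\<close>; so \<open>C(a) = Ann(B)\<close>, and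
  \<open>Pb(B) = m + (1 - m) m\<close>. This is \<open>1\<close>, \<open>3/4\<close>, \<open>5/9\<close> for \<open>n = 1, 2, 3\<close>, and of these only
  \<open>5/9\<close> is below \<open>5/8\<close>.

  Since Borel sets of \<open>B \<times> B\<close> need not lie in the product \<open>\<sigma>\<close>-algebra, Fubini's theorem is
  replaced by an estimate for closed sets (\<open>emeasure_closed_strip_le\<close>) that rests on compactness
  and outer regularity.
\<close>

section \<open>Product measures of closed sets\<close>

text \<open>
  Half of Fubini's theorem, without product measurability. Enlarge the slice of \<open>Z\<close> over \<open>a\<close> to
  an open set \<open>U a\<close> of measure less than \<open>s\<close>, where \<open>s > t\<close>. By the tube lemma the slices over
  all points near \<open>a\<close> also lie in \<open>U a\<close>, so by compactness finitely many rectangles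
  \<open>V a \<times> U a\<close> cover the strip, and cutting their bases down to disjoint sets bounds its measure
  by \<open>s * M C\<close>. Letting \<open>s\<close> tend to \<open>t\<close> gives the claim.
\<close>

lemma emeasure_closed_strip_le:
  fixes M :: "'a::t2_space measure" and N :: "'b::topological_space measure"
    and P :: "('a \<times> 'b) measure"
  assumes compact_a: "compact (UNIV :: 'a set)" and compact_b: "compact (UNIV :: 'b set)"
    and sets_P: "sets P = sets borel" and sets_M: "sets M = sets borel"
    and rect: "\<And>A B. A \<in> sets borel \<Longrightarrow> B \<in> sets borel \<Longrightarrow>
                 emeasure P (A \<times> B) = emeasure M A * emeasure N B"
    and outer: "\<And>A. A \<in> sets borel \<Longrightarrow>
                 emeasure N A = (INF U\<in>{U. open U \<and> A \<subseteq> U}. emeasure N U)"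
    and Z: "closed Z" and C: "closed C"
    and slices: "\<And>a. a \<in> C \<Longrightarrow> emeasure N (Pair a -` Z) \<le> t"
    and t: "t < \<infinity>" and fin: "emeasure M C < \<infinity>"
  shows "emeasure P (Z \<inter> C \<times> UNIV) \<le> t * emeasure M C"
proof -
  have *: "emeasure P (Z \<inter> C \<times> UNIV) \<le> s * emeasure M C" if s: "t < s" for s
  proof -
    have "\<exists>U. open U \<and> Pair a -` Z \<subseteq> U \<and> emeasure N U < s" if "a \<in> C" for a
    proof -
      have "closed (Pair a -` Z)"
        by (intro closed_vimage Z continuous_intros)
      then have "(INF U\<in>{U. open U \<and> Pair a -` Z \<subseteq> U}. emeasure N U) < s"
        using slices[OF that] s outer[of "Pair a -` Z"] by auto
      then show ?thesis
        by (auto simp: INF_less_iff)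
    qed
    then obtain U where U: "\<And>a. a \<in> C \<Longrightarrow> open (U a)" "\<And>a. a \<in> C \<Longrightarrow> Pair a -` Z \<subseteq> U a"
        "\<And>a. a \<in> C \<Longrightarrow> emeasure N (U a) < s"
      by metis
    define V where "V a = {x. Pair x -` Z \<subseteq> U a}" for a
    have V: "open (V a)" if "a \<in> C" for a
    proof -
      have "compact (Z \<inter> (UNIV \<times> - U a))"
      proof -
        have "closed (Z \<inter> (UNIV \<times> - U a))"
          using U(1)[OF that] Z by (intro closed_Int closed_Times) auto
        moreover have "compact (UNIV :: ('a \<times> 'b) set)"
          using compact_Times[OF compact_a compact_b] by simp
        ultimately show ?thesis
          by (metis compact_Int_closed inf_top_left)
      qed
      then have "compact (fst ` (Z \<inter> (UNIV \<times> - U a)))"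
        by (intro compact_continuous_image continuous_intros)
      then have "closed (fst ` (Z \<inter> (UNIV \<times> - U a)))"
        by (rule compact_imp_closed)
      moreover have "V a = - fst ` (Z \<inter> (UNIV \<times> - U a))"
        by (force simp: V_def)
      ultimately show ?thesis
        by auto
    qed
    have "compact C"
      using compact_Int_closed[OF compact_a C] by simp
    moreover have "C \<subseteq> (\<Union>a\<in>C. V a)"
      using U(2) by (auto simp: V_def)
    ultimately obtain F where F: "F \<subseteq> C" "finite F" "C \<subseteq> (\<Union>a\<in>F. V a)"
      using compactE_image[of C C V] V by metis
    \<comment> \<open>A statement about all Borel bases \<open>A\<close>, so that the induction can split off \<open>A \<inter> V a\<close>.\<close>
    have "emeasure P (Z \<inter> A \<times> UNIV) \<le> s * emeasure M A"
      if "A \<in> sets borel" "A \<subseteq> (\<Union>a\<in>F. V a)" for A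
      using F(2) F(1) that
    proof (induction F arbitrary: A)
      case empty
      then show ?case by simp
    next
      case (insert a F)
      have a: "a \<in> C" using insert by auto
      have Va: "V a \<in> sets borel" and Ua: "U a \<in> sets borel"
        using V[OF a] U(1)[OF a] by auto
      have Zb: "Z \<in> sets borel" using Z by auto
      have A: "A \<in> sets borel" by fact
      have meas: "Z \<inter> B \<times> UNIV \<in> sets P" if "B \<in> sets borel" for B
        unfolding sets_P using that Zb by (intro sets.Int borel_Times) auto
      have "Z \<inter> A \<times> UNIV = (Z \<inter> (A \<inter> V a) \<times> UNIV) \<union> (Z \<inter> (A - V a) \<times> UNIV)"
        by auto
      then have "emeasure P (Z \<inter> A \<times> UNIV) \<le>
          emeasure P (Z \<inter> (A \<inter> V a) \<times> UNIV) + emeasure P (Z \<inter> (A - V a) \<times> UNIV)"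
        using emeasure_subadditive[OF meas meas, of "A \<inter> V a" "A - V a"] A Va by auto
      also have "emeasure P (Z \<inter> (A \<inter> V a) \<times> UNIV) \<le> emeasure P ((A \<inter> V a) \<times> U a)"
        using A Va Ua by (intro emeasure_mono) (auto simp: V_def sets_P intro!: borel_Times)
      also have "\<dots> = emeasure M (A \<inter> V a) * emeasure N (U a)"
        using A Va Ua by (intro rect) auto
      also have "\<dots> \<le> s * emeasure M (A \<inter> V a)"
        using U(3)[OF a] by (subst mult.commute) (intro mult_right_mono, auto)
      also have "emeasure P (Z \<inter> (A - V a) \<times> UNIV) \<le> s * emeasure M (A - V a)"
        using insert.prems A Va by (intro insert.IH) auto
      also have "s * emeasure M (A \<inter> V a) + s * emeasure M (A - V a) = s * emeasure M A"
      proof -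
        have "emeasure M (A \<inter> V a) + emeasure M (A - V a) = emeasure M A"
          using A Va by (subst plus_emeasure) (auto simp: sets_M intro!: arg_cong[where f = "emeasure M"])
        then show ?thesis by (simp flip: distrib_left)
      qed
      finally show ?case by (simp add: add_mono)
    qed
    then show ?thesis
      using C F(3) by auto
  qed
  show ?thesis
  proof (rule ennreal_le_epsilon)
    fix e :: real assume e: "0 < e"
    \<comment> \<open>The increment \<open>e / (m + 1)\<close> also makes sense for \<open>m = 0\<close>.\<close>
    define m where "m = enn2real (emeasure M C)"
    have m: "emeasure M C = ennreal m" "0 \<le> m"
      using fin by (auto simp: m_def)
    have d: "0 < e / (m + 1)" using e m by auto
    have "t < t + ennreal (e / (m + 1))"
      using t d by (simp add: ennreal_add_left_cancel_less[of t 0, simplified])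
    from *[OF this] have "emeasure P (Z \<inter> C \<times> UNIV) \<le> (t + ennreal (e / (m + 1))) * emeasure M C" .
    also have "\<dots> = t * emeasure M C + ennreal (e / (m + 1) * m)"
      by (simp only: m(1) distrib_right ennreal_mult[OF less_imp_le[OF d] m(2)])
    also have "\<dots> \<le> t * emeasure M C + ennreal e"
      using m e by (intro add_left_mono ennreal_leI) (auto simp: field_simps)
    finally show "emeasure P (Z \<inter> C \<times> UNIV) \<le> t * emeasure M C + ennreal e" .
  qed
qed

section \<open>Invariance of Haar measure\<close>

lemma left_translate_eq_vimage: "(\<lambda>x. a + x) ` A = (\<lambda>x. - a + x) -` (A :: 'a::group_add set)"
proof (intro set_eqI iffI)
  fix x assume "x \<in> (\<lambda>x. - a + x) -` A"
  then show "x \<in> (\<lambda>x. a + x) ` A"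
    by (intro image_eqI[of _ _ "- a + x"]) simp_all
qed auto

locale compact_group_haar =
  fixes \<mu> :: "'a::{topological_group_add,t2_space} measure"
    and P :: "('a \<times> 'a) measure"
  assumes compact_group: "compact (UNIV :: 'a set)"
    and haar: "haar_probability \<mu>"
    and radon_product: "is_radon_product \<mu> \<mu> P"
begin

lemma sets_haar: "sets \<mu> = sets borel" and sets_product: "sets P = sets borel"
  using haar radon_product
  by (auto simp: haar_probability_def is_radon_product_def radon_measure_def)

lemma space_haar: "space \<mu> = UNIV" and space_product: "space P = UNIV"
  using sets_eq_imp_space_eq[OF sets_haar] sets_eq_imp_space_eq[OF sets_product] by auto

lemma haar_outer:
  "A \<in> sets borel \<Longrightarrow> emeasure \<mu> A = (INF U\<in>{U. open U \<and> A \<subseteq> U}. emeasure \<mu> U)"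
  using haar by (auto simp: haar_probability_def radon_measure_def)

lemma product_outer:
  "A \<in> sets borel \<Longrightarrow> emeasure P A = (INF U\<in>{U. open U \<and> A \<subseteq> U}. emeasure P U)"
  using radon_product by (auto simp: is_radon_product_def radon_measure_def)

lemma haar_translate: "A \<in> sets borel \<Longrightarrow> emeasure \<mu> ((\<lambda>x. a + x) ` A) = emeasure \<mu> A"
  using haar by (auto simp: haar_probability_def)

lemma product_rectangle:
  "A \<in> sets borel \<Longrightarrow> B \<in> sets borel \<Longrightarrow>
    emeasure P (A \<times> B) = emeasure \<mu> A * emeasure \<mu> B"
  using radon_product by (auto simp: is_radon_product_def)

sublocale haar: prob_space \<mu>
  using haar by (simp add: haar_probability_def)

sublocale product: prob_space P
proof
  show "emeasure P (space P) = 1"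
    using product_rectangle[of UNIV UNIV] haar.emeasure_space_1
    by (simp add: space_haar space_product)
qed

lemma product_strip_le:
  assumes "closed Z" "closed C" "\<And>a. a \<in> C \<Longrightarrow> emeasure \<mu> (Pair a -` Z) \<le> t" "t < \<infinity>"
  shows "emeasure P (Z \<inter> C \<times> UNIV) \<le> t * emeasure \<mu> C"
  by (rule emeasure_closed_strip_le[OF compact_group compact_group sets_product sets_haar
        product_rectangle haar_outer assms]) (auto simp: haar.emeasure_eq_measure)

text \<open>
  The image of \<open>P\<close> under swapping the coordinates has the same values on rectangles as \<open>P\<close>, so the
  strip estimate applies to it.
\<close>

lemma product_swapped_le:
  assumes Z: "closed Z" and slices: "\<And>b. emeasure \<mu> ((\<lambda>a. (a, b)) -` Z) \<le> t" and t: "t < \<infinity>"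
  shows "emeasure P Z \<le> t"
proof -
  define Q where "Q = distr P borel prod.swap"
  have swap: "prod.swap \<in> measurable P borel"
    unfolding measurable_cong_sets[OF sets_product refl]
    by (intro borel_measurable_continuous_onI continuous_on_swap)
  have Q: "emeasure Q A = emeasure P (prod.swap -` A)" if "A \<in> sets borel" for A
    using that swap by (simp add: Q_def emeasure_distr space_product)
  have swapZ: "closed (prod.swap -` Z)"
    using Z by (intro closed_vimage continuous_on_swap)
  have "emeasure Q (prod.swap -` Z \<inter> UNIV \<times> UNIV) \<le> t * emeasure \<mu> UNIV"
  proof (rule emeasure_closed_strip_le[OF compact_group compact_group _ sets_haar _ haar_outer swapZ])
    show "emeasure Q (A \<times> B) = emeasure \<mu> A * emeasure \<mu> B"
      if "A \<in> sets borel" "B \<in> sets borel" for A B :: "'a set"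
    proof -
      have "prod.swap -` (A \<times> B) = B \<times> A" by auto
      then show ?thesis
        using that by (simp add: Q borel_Times product_rectangle mult.commute)
    qed
    show "emeasure \<mu> (Pair b -` prod.swap -` Z) \<le> t" for b
      using slices[of b] by (simp add: vimage_def)
  qed (use t in \<open>auto simp: Q_def haar.emeasure_eq_measure\<close>)
  moreover have "prod.swap -` prod.swap -` Z = Z" by (auto simp: vimage_def)
  ultimately show ?thesis
    using swapZ haar.emeasure_space_1 by (simp add: Q space_haar)
qed

text \<open>
  This contains the uniqueness argument for Haar measure. Let \<open>s (x, y) = - \<phi> y + x\<close>. For fixed
  \<open>y\<close> the slice of \<open>s -` K\<close> is \<open>\<phi> y + K\<close>, a translate of \<open>K\<close>. For fixed \<open>x = \<phi> z\<close> it is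
  \<open>z + {y. - \<phi> y \<in> K}\<close>; this is where surjectivity enters, and the minus sign makes the
  translation act on the left, the only side on which invariance is known. Hence the measure of
  \<open>s -` K\<close> lies between the two sides of the claim.
\<close>

lemma haar_le_endomorphism:
  assumes cont: "continuous_on UNIV \<phi>" and add: "\<And>x y. \<phi> (x + y) = \<phi> x + \<phi> y"
    and surj: "surj \<phi>" and K: "closed K"
  shows "emeasure \<mu> K \<le> emeasure \<mu> {y. - \<phi> y \<in> K}"
proof -
  define s where "s p = - \<phi> (snd p) + fst p" for p :: "'a \<times> 'a"
  have cont_s: "continuous_on UNIV s"
    unfolding s_def
    by (intro continuous_intros continuous_on_compose2[OF cont]) auto
  have "emeasure P (s -` K) \<le> emeasure \<mu> {y. - \<phi> y \<in> K}"
  proof -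
    have "closed ((\<lambda>y. - \<phi> y) -` K)"
      using K cont by (intro closed_vimage continuous_intros)
    then have borel: "{y. - \<phi> y \<in> K} \<in> sets borel"
      by (simp add: vimage_def)
    have "emeasure P (s -` K \<inter> UNIV \<times> UNIV) \<le> emeasure \<mu> {y. - \<phi> y \<in> K} * emeasure \<mu> UNIV"
    proof (rule product_strip_le)
      fix x
      obtain z where z: "x = \<phi> z" using surj by (metis surjD)
      have *: "- \<phi> (z + y) + x = - \<phi> y" for y
        by (simp add: z add minus_add add.assoc)
      have "Pair x -` s -` K = (\<lambda>y. z + y) ` {y. - \<phi> y \<in> K}"
        unfolding left_translate_eq_vimage
        using *[of "- z + _"] by (auto simp: s_def simp flip: add.assoc)
      then show "emeasure \<mu> (Pair x -` s -` K) \<le> emeasure \<mu> {y. - \<phi> y \<in> K}"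
        using haar_translate[OF borel] by simp
    qed (use K cont_s in \<open>auto intro: closed_vimage simp: haar.emeasure_eq_measure\<close>)
    then show ?thesis
      using haar.emeasure_space_1 by (simp add: space_haar)
  qed
  moreover have "emeasure \<mu> K \<le> emeasure P (s -` K)"
  proof -
    \<comment> \<open>The slice estimate bounds closed sets from above, hence open sets from below. So \<open>s -` K\<close> is
      approximated by open sets \<open>W\<close>, and each \<open>W\<close> is shrunk to the preimage of an open \<open>V\<close>.\<close>
    have "emeasure \<mu> K \<le> emeasure P W" if W: "open W" "s -` K \<subseteq> W" for W
    proof -
      define V where "V = - s ` (- W)"
      have "compact (- W)"
        using compact_Int_closed[OF compact_Times[OF compact_group compact_group], of "- W"] W(1)
        by (simp add: closed_Compl)
      then have "compact (s ` (- W))"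
        using cont_s by (intro compact_continuous_image) (auto intro: continuous_on_subset)
      then have V: "open V"
        by (auto simp: V_def dest: compact_imp_closed)
      have KV: "K \<subseteq> V" and VW: "s -` V \<subseteq> W"
        using W(2) by (auto simp: V_def)
      have closed_compl: "closed (s -` (- V))"
        using V cont_s by (intro closed_vimage) auto
      have "emeasure P (s -` (- V)) \<le> emeasure \<mu> (- V)"
      proof (rule product_swapped_le)
        fix y
        have "(\<lambda>x. (x, y)) -` s -` (- V) = (\<lambda>x. \<phi> y + x) ` (- V)"
          unfolding left_translate_eq_vimage by (auto simp: s_def)
        then show "emeasure \<mu> ((\<lambda>x. (x, y)) -` s -` (- V)) \<le> emeasure \<mu> (- V)"
          using haar_translate[of "- V" "\<phi> y"] V by simp
      qed (use closed_compl in \<open>auto simp: haar.emeasure_eq_measure\<close>)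
      then have "measure P (s -` (- V)) \<le> measure \<mu> (- V)"
        by (simp add: haar.emeasure_eq_measure product.emeasure_eq_measure)
      moreover have "measure \<mu> (- V) = 1 - measure \<mu> V"
        using haar.prob_compl[of V] V by (simp add: sets_haar space_haar Compl_eq_Diff_UNIV)
      moreover have "measure P (- (s -` V)) = 1 - measure P (s -` V)"
        using product.prob_compl[of "s -` V"] open_vimage[OF V cont_s]
        by (simp add: sets_product space_product Compl_eq_Diff_UNIV)
      ultimately have "measure \<mu> V \<le> measure P (s -` V)"
        by (simp add: vimage_Compl)
      moreover have "measure \<mu> K \<le> measure \<mu> V"
        using KV V by (intro haar.finite_measure_mono) (auto simp: sets_haar)
      moreover have "measure P (s -` V) \<le> measure P W"
        using VW W by (intro product.finite_measure_mono) (auto simp: sets_product)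
      ultimately show ?thesis
        by (simp add: haar.emeasure_eq_measure product.emeasure_eq_measure)
    qed
    moreover have "s -` K \<in> sets borel"
      using closed_vimage[OF K cont_s] by auto
    ultimately show ?thesis
      by (subst product_outer) (auto intro!: INF_greatest)
  qed
  ultimately show ?thesis by (rule order_trans[rotated])
qed

text \<open>
  The case \<open>\<phi> = id\<close> of the previous lemma compares \<open>K\<close> with \<open>- K\<close>; applying the lemma again to
  \<open>- K\<close> cancels the sign.
\<close>

corollary haar_le_vimage:
  assumes cont: "continuous_on UNIV \<phi>" and add: "\<And>x y. \<phi> (x + y) = \<phi> x + \<phi> y"
    and surj: "surj \<phi>" and K: "closed K"
  shows "measure \<mu> K \<le> measure \<mu> (\<phi> -` K)"
proof -
  have "emeasure \<mu> K \<le> emeasure \<mu> (uminus -` K)"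
    using haar_le_endomorphism[of "\<lambda>x. x" K] K by (simp add: vimage_def)
  also have "\<dots> \<le> emeasure \<mu> {y. - \<phi> y \<in> uminus -` K}"
    using cont add surj K
    by (intro haar_le_endomorphism closed_vimage continuous_intros) auto
  also have "{y. - \<phi> y \<in> uminus -` K} = \<phi> -` K" by auto
  finally show ?thesis by (simp add: haar.emeasure_eq_measure)
qed

end

section \<open>Centralizers in a skew left brace\<close>

interpretation circ: Groups.group "(\<odot>) :: 'a::skew_left_brace \<Rightarrow> 'a \<Rightarrow> 'a" 0 circ_inverse
  using circ_group[where ?'a = 'a] by (simp add: circ_one_eq_0)

definition brace_lambda :: "'a::skew_left_brace \<Rightarrow> 'a \<Rightarrow> 'a" where
  "brace_lambda a b = - a + a \<odot> b"

lemma circ_eq_add_lambda: "a \<odot> b = a + brace_lambda a b"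
  by (simp add: brace_lambda_def flip: add.assoc)

lemma brace_lambda_add: "brace_lambda a (b + c) = brace_lambda a b + brace_lambda a c"
  by (simp add: brace_lambda_def circ_add add.assoc diff_conv_add_uminus del: add_uminus_conv_diff)

lemma circ_uminus_add: "a \<odot> (- b + c) = a - a \<odot> b + a \<odot> c"
proof -
  have "a \<odot> c = a \<odot> b - a + a \<odot> (- b + c)"
    using circ_add[of a b "- b + c"] by (simp flip: add.assoc)
  then have "a - a \<odot> b + a \<odot> c = a - a \<odot> b + (a \<odot> b - a + a \<odot> (- b + c))"
    by simp
  also have "\<dots> = a \<odot> (- b + c)"
    by (simp add: diff_conv_add_uminus add.assoc del: add_uminus_conv_diff)
  finally show ?thesis by simp
qed

lemma brace_lambda_circ: "brace_lambda (a \<odot> b) c = brace_lambda a (brace_lambda b c)"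
  by (simp add: brace_lambda_def[of a] circ_uminus_add brace_lambda_def[of b]
      brace_lambda_def[of "a \<odot> b"] circ.assoc diff_conv_add_uminus add.assoc
      del: add_uminus_conv_diff)

text \<open>
  By the previous lemma \<open>\<lambda>\<close> is an action of \<open>(B, \<circ>)\<close>, so \<open>\<lambda>\<^sub>a\<close> is inverted by \<open>\<lambda>\<close> of the
  \<open>\<circ>\<close>-inverse of \<open>a\<close>.
\<close>

lemma surj_brace_lambda: "surj (brace_lambda a)"
proof (rule surjI)
  show "brace_lambda a (brace_lambda (circ_inverse a) y) = y" for y
    by (simp add: brace_lambda_def[of 0] flip: brace_lambda_circ)
qed

definition brace_centralizer :: "'a::skew_left_brace \<Rightarrow> 'a set" where
  "brace_centralizer a = {b. a + b = b + a \<and> b + a = a \<odot> b \<and> a \<odot> b = b \<odot> a}"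

lemma commuting_pairs_eq: "commuting_pairs = {(a, b). b \<in> brace_centralizer a}"
proof -
  have 1: "- a + c - b = 0 \<longleftrightarrow> c = a + b" for a b c :: 'a
    by (metis right_minus_eq add_minus_cancel minus_add_cancel)
  have 2: "a + b - a - b = 0 \<longleftrightarrow> a + b = b + a" for a b :: 'a
    by (simp only: right_minus_eq diff_eq_eq add_0)
  have 3: "a \<odot> b = a + b \<and> b \<odot> a = b + a \<and> a + b = b + a \<longleftrightarrow>
      a + b = b + a \<and> b + a = a \<odot> b \<and> a \<odot> b = b \<odot> a" for a b :: 'a
    by metis
  show ?thesis
    unfolding commuting_pairs_def brace_centralizer_def brace_star_def add_commutator_def 1 2 3
      mem_Collect_eq ..
qed

lemma brace_centralizer_sym: "b \<in> brace_centralizer a \<longleftrightarrow> a \<in> brace_centralizer b"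
  unfolding brace_centralizer_def mem_Collect_eq by metis

lemma annihilator_iff: "z \<in> annihilator \<longleftrightarrow> brace_centralizer z = UNIV"
  unfolding annihilator_def brace_centralizer_def by blast

lemma annihilator_eq: "annihilator = (\<Inter>a. brace_centralizer a)"
  using brace_centralizer_sym unfolding set_eq_iff annihilator_iff by blast

text \<open>
  Expanding \<open>b \<circ> (a + c) = b \<circ> (c + a)\<close> with the brace law in both ways shows that \<open>a\<close> commutes
  additively with \<open>b \<circ> c\<close>; the right-hand side is also \<open>b \<circ> c \<circ> a\<close>, which supplies the remaining
  equation.
\<close>

lemma circ_in_centralizer:
  assumes b: "b \<in> brace_centralizer a" and c: "c \<in> brace_centralizer a"
  shows "b \<odot> c \<in> brace_centralizer a"
proof -
  have "b \<odot> (a + c) = a + b \<odot> c"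
    using b circ_add[of b a c] by (auto simp: brace_centralizer_def)
       (metis add_diff_cancel)
  moreover have "b \<odot> (c + a) = b \<odot> c + a"
    using b circ_add[of b c a] by (auto simp: brace_centralizer_def)
       (metis add.assoc diff_add_cancel)
  ultimately have 1: "a + b \<odot> c = b \<odot> c + a"
    using c by (auto simp: brace_centralizer_def)
  have 2: "a \<odot> (b \<odot> c) = b \<odot> c \<odot> a"
    using b c by (simp add: brace_centralizer_def) (metis circ.assoc)
  have "b \<odot> c \<odot> a = b \<odot> (c + a)"
    using c by (simp add: brace_centralizer_def circ.assoc)
  with \<open>b \<odot> (c + a) = b \<odot> c + a\<close> 1 2 show ?thesis
    by (auto simp: brace_centralizer_def)
qed

text \<open>
  With \<open>b'\<close> the \<open>\<circ>\<close>-inverse of \<open>b\<close>, both \<open>b \<circ> (a + b')\<close> and \<open>b \<circ> (b' + a)\<close> expand to \<open>a\<close>, so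
  \<open>a + b'\<close> and \<open>b' + a\<close> both equal \<open>b' \<circ> a\<close>.
\<close>

lemma circ_inverse_in_centralizer:
  assumes b: "b \<in> brace_centralizer a"
  shows "circ_inverse b \<in> brace_centralizer a"
proof -
  let ?b = "circ_inverse b"
  have ba: "b \<odot> a = a + b" "b \<odot> a = b + a"
    using b by (auto simp: brace_centralizer_def)
  have "b \<odot> (a + ?b) = a"
    by (simp add: circ_add ba(1))
  moreover have "b \<odot> (?b + a) = a"
    by (simp add: circ_add ba(2))
  moreover have "?b \<odot> (b \<odot> x) = x" for x
    by (simp flip: circ.assoc)
  ultimately have 1: "a + ?b = ?b \<odot> a" "?b + a = ?b \<odot> a"
    by metis+
  have "a \<odot> ?b = ?b \<odot> (b \<odot> a) \<odot> ?b"
    by (simp flip: circ.assoc)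
  also have "b \<odot> a = a \<odot> b"
    using b by (simp add: brace_centralizer_def)
  also have "?b \<odot> (a \<odot> b) \<odot> ?b = ?b \<odot> a"
    by (simp add: circ.assoc)
  finally have "a \<odot> ?b = ?b \<odot> a" .
  with 1 show ?thesis
    by (auto simp: brace_centralizer_def)
qed

lemma circ_in_centralizer_iff:
  assumes "b \<in> brace_centralizer a"
  shows "c \<odot> b \<in> brace_centralizer a \<longleftrightarrow> c \<in> brace_centralizer a"
proof
  assume "c \<odot> b \<in> brace_centralizer a"
  from circ_in_centralizer[OF this circ_inverse_in_centralizer[OF assms]]
  show "c \<in> brace_centralizer a" by (simp add: circ.assoc)
qed (use assms circ_in_centralizer in blast)

lemma annihilator_circ:
  assumes "z \<in> annihilator"
  shows "z \<odot> b = z + b" "b \<odot> z = b + z"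
  using assms unfolding annihilator_def mem_Collect_eq by metis+

lemma annihilator_add:
  assumes "z \<in> annihilator" "w \<in> annihilator"
  shows "z + w \<in> annihilator"
proof -
  have "z + w = z \<odot> w"
    using assms(1) by (simp add: annihilator_circ)
  then show ?thesis
    using assms by (auto simp: annihilator_eq intro: circ_in_centralizer)
qed

lemma annihilator_uminus:
  assumes "z \<in> annihilator"
  shows "- z \<in> annihilator"
proof -
  have "z \<odot> (- z) = 0"
    using assms by (simp add: annihilator_circ)
  then have "- z = circ_inverse z"
    by (metis circ.inverse_unique)
  then show ?thesis
    using assms by (auto simp: annihilator_eq intro: circ_inverse_in_centralizer)
qed

lemma zero_in_annihilator: "0 \<in> annihilator"
  by (simp add: annihilator_def circ_eq_add_lambda[of 0] brace_lambda_def[of 0])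

abbreviation annihilator_coset :: "'a::skew_left_brace \<Rightarrow> 'a set" where
  "annihilator_coset a \<equiv> (\<lambda>z. a + z) ` annihilator"

lemma annihilator_coset_iff: "x \<in> annihilator_coset a \<longleftrightarrow> - a + x \<in> annihilator"
  by (simp add: left_translate_eq_vimage)

lemma mem_annihilator_coset: "x \<in> annihilator_coset x"
  by (simp add: annihilator_coset_iff zero_in_annihilator)

lemma annihilator_coset_eqI:
  assumes "x \<in> annihilator_coset a"
  shows "annihilator_coset x = annihilator_coset a"
proof -
  have ax: "- a + x \<in> annihilator"
    using assms by (simp only: annihilator_coset_iff)
  have "- x + y \<in> annihilator \<longleftrightarrow> - a + y \<in> annihilator" for y
    using annihilator_add[OF ax, of "- x + y"]
      annihilator_add[OF annihilator_uminus[OF ax], of "- a + y"]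
    by (auto simp: add.assoc minus_add)
  then show ?thesis
    by (intro set_eqI) (simp only: annihilator_coset_iff)
qed

lemma annihilator_cosets_disjoint:
  assumes "S \<in> annihilator_quotient" "T \<in> annihilator_quotient" "S \<noteq> T"
  shows "S \<inter> T = {}"
proof (rule ccontr)
  obtain a b where ab: "S = annihilator_coset a" "T = annihilator_coset b"
    using assms(1,2) unfolding annihilator_quotient_def by blast
  assume "S \<inter> T \<noteq> {}"
  then obtain x where "x \<in> annihilator_coset a" "x \<in> annihilator_coset b"
    unfolding ab by blast
  then show False
    using assms(3) annihilator_coset_eqI ab by metis
qed

text \<open>
  The link between additive cosets and the multiplicative subgroup \<open>C(a)\<close>: for \<open>z\<close> in the
  annihilator, \<open>b + z = b \<circ> z\<close>.
\<close>

lemma annihilator_coset_subset_centralizer: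
  assumes "b \<in> brace_centralizer a"
  shows "annihilator_coset b \<subseteq> brace_centralizer a"
proof
  fix x assume "x \<in> annihilator_coset b"
  then obtain z where z: "z \<in> annihilator" "x = b + z" by auto
  then have "x = b \<odot> z"
    by (simp add: annihilator_circ)
  then show "x \<in> brace_centralizer a"
    using z(1) assms by (auto simp: annihilator_eq intro: circ_in_centralizer)
qed

section \<open>Measures of centralizers and of the annihilator\<close>

lemma continuous_on_circ:
  fixes f g :: "'b::topological_space \<Rightarrow> 'a::topological_skew_left_brace"
  assumes "continuous_on S f" "continuous_on S g"
  shows "continuous_on S (\<lambda>x. f x \<odot> g x)"
  unfolding continuous_on_def
proof
  fix x assume "x \<in> S"
  then show "((\<lambda>x. f x \<odot> g x) \<longlongrightarrow> f x \<odot> g x) (at x within S)"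
    using assms filterlim_compose[OF tendsto_circ_nhds filterlim_Pair, of f "f x" _ g "g x"]
    by (simp add: continuous_on_def)
qed

lemma continuous_on_brace_lambda:
  "continuous_on UNIV (brace_lambda a :: 'a::topological_skew_left_brace \<Rightarrow> 'a)"
  unfolding brace_lambda_def[abs_def] by (intro continuous_intros continuous_on_circ)

lemma closed_commuting_pairs:
  "closed (commuting_pairs :: ('a::compact_skew_left_brace \<times> 'a) set)"
proof -
  have *: "commuting_pairs = {p :: 'a \<times> 'a. fst p + snd p = snd p + fst p} \<inter>
      {p. snd p + fst p = fst p \<odot> snd p} \<inter> {p. fst p \<odot> snd p = snd p \<odot> fst p}"
    by (auto simp: commuting_pairs_eq brace_centralizer_def)
  show ?thesis
    unfolding * by (intro closed_Int closed_Collect_eq continuous_intros continuous_on_circ)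
qed

lemma centralizer_eq_slice: "brace_centralizer a = Pair a -` commuting_pairs"
  unfolding commuting_pairs_eq by auto

lemma closed_centralizer: "closed (brace_centralizer (a :: 'a::compact_skew_left_brace))"
proof -
  have "continuous_on UNIV (Pair a)"
    by (intro continuous_intros)
  then show ?thesis
    unfolding centralizer_eq_slice by (rule closed_vimage[OF closed_commuting_pairs])
qed

lemma closed_annihilator: "closed (annihilator :: 'a::compact_skew_left_brace set)"
  unfolding annihilator_eq by (simp add: closed_INT closed_centralizer)

locale compact_brace_haar = compact_group_haar \<mu> P
  for \<mu> :: "'a::compact_skew_left_brace measure" and P
begin

text \<open>
  For \<open>c\<close> outside the subgroup \<open>D = C(a)\<close> of \<open>(B, \<circ>)\<close>, the translate \<open>E = {w. c \<circ> w \<in> D}\<close> is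
  disjoint from \<open>D\<close>. With \<open>c'\<close> the \<open>\<circ>\<close>-inverse of \<open>c\<close>, it is also the additive translate by \<open>c'\<close>
  of the preimage of \<open>D\<close> under \<open>\<lambda>\<^sub>c\<close>, and therefore at least as large as \<open>D\<close>.
\<close>

lemma centralizer_le_half:
  assumes "brace_centralizer a \<noteq> UNIV"
  shows "measure \<mu> (brace_centralizer a) \<le> 1 / 2"
proof -
  let ?D = "brace_centralizer a"
  obtain c where c: "c \<notin> ?D" using assms by auto
  define E where "E = {w. c \<odot> w \<in> ?D}"
  have "brace_lambda c (- circ_inverse c + w) = c \<odot> w" for w
    by (simp add: brace_lambda_def circ_uminus_add flip: add.assoc)
  then have "E = (\<lambda>y. circ_inverse c + y) ` (brace_lambda c -` ?D)"
    by (simp add: E_def left_translate_eq_vimage vimage_def)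
  moreover have closed_E: "closed (brace_lambda c -` ?D)"
    by (intro closed_vimage closed_centralizer continuous_on_brace_lambda)
  ultimately have "emeasure \<mu> E = emeasure \<mu> (brace_lambda c -` ?D)"
    using haar_translate by auto
  then have "measure \<mu> ?D \<le> measure \<mu> E"
    using haar_le_vimage[OF continuous_on_brace_lambda brace_lambda_add surj_brace_lambda
        closed_centralizer, of a c]
    by (simp add: haar.emeasure_eq_measure)
  moreover have "E \<inter> ?D = {}"
    using c circ_in_centralizer_iff by (auto simp: E_def)
  moreover have "E = (\<lambda>w. c \<odot> w) -` ?D"
    by (auto simp: E_def)
  then have "closed E"
    by (auto intro!: closed_vimage closed_centralizer continuous_intros continuous_on_circ)
  ultimately have "measure \<mu> ?D + measure \<mu> ?D \<le> measure \<mu> (E \<union> ?D)"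
    using closed_centralizer[of a]
    by (subst haar.finite_measure_Union) (auto simp: sets_haar)
  also have "\<dots> \<le> 1" by simp
  finally show ?thesis by simp
qed

lemma measure_Union_cosets:
  assumes "finite \<T>" "\<T> \<subseteq> annihilator_quotient"
  shows "measure \<mu> (\<Union>\<T>) = card \<T> * measure \<mu> annihilator"
proof -
  have borel: "annihilator \<in> sets (borel :: 'a measure)"
    by (rule borel_closed[OF closed_annihilator])
  have coset: "T \<in> sets borel \<and> measure \<mu> T = measure \<mu> annihilator" if T: "T \<in> \<T>" for T
  proof -
    obtain a where a: "T = annihilator_coset a"
      using assms T by (auto simp: annihilator_quotient_def)
    have "annihilator_coset a = (\<lambda>x. - a + x) -` annihilator"
      by (rule left_translate_eq_vimage)
    moreover have "closed ((\<lambda>x. - a + x) -` annihilator)"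
      by (intro closed_vimage closed_annihilator continuous_intros)
    ultimately show ?thesis
      using haar_translate[OF borel, of a] by (simp add: a haar.emeasure_eq_measure)
  qed
  have "measure \<mu> (\<Union>T\<in>\<T>. T) = (\<Sum>T\<in>\<T>. measure \<mu> T)"
  proof (rule haar.finite_measure_finite_Union[OF assms(1)])
    show "disjoint_family_on (\<lambda>T. T) \<T>"
      using assms(2) annihilator_cosets_disjoint unfolding disjoint_family_on_def by blast
  qed (use coset sets_haar in auto)
  then show ?thesis
    using coset by simp
qed

lemma index_times_measure:
  assumes "finite (annihilator_quotient :: 'a set set)"
  shows "card (annihilator_quotient :: 'a set set) * measure \<mu> annihilator = 1"
proof -
  have "x \<in> \<Union>annihilator_quotient" for x :: 'a
    using mem_annihilator_coset[of x] unfolding annihilator_quotient_def by blast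
  then have "\<Union>annihilator_quotient = (UNIV :: 'a set)"
    by blast
  then show ?thesis
    using measure_Union_cosets[OF assms] haar.prob_space by (simp add: space_haar)
qed

text \<open>
  If the index of the annihilator is at most \<open>3\<close>, two of its cosets already have measure at least
  \<open>2/3\<close>, which is more than a proper centralizer can contain.
\<close>

lemma centralizer_eq_annihilator:
  fixes a :: 'a
  assumes fin: "finite (annihilator_quotient :: 'a set set)"
    and card: "card (annihilator_quotient :: 'a set set) \<le> 3"
    and a: "a \<notin> annihilator"
  shows "brace_centralizer a = annihilator"
proof (rule ccontr)
  assume "brace_centralizer a \<noteq> annihilator"
  then obtain b where b: "b \<in> brace_centralizer a" "b \<notin> annihilator"
    by (auto simp: annihilator_eq)
  let ?T = "{annihilator_coset b, annihilator_coset 0}"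
  have "annihilator_coset b \<noteq> annihilator_coset 0"
    using b(2) mem_annihilator_coset[of b] by auto
  moreover have "?T \<subseteq> annihilator_quotient"
    unfolding annihilator_quotient_def by blast
  ultimately have "2 * measure \<mu> annihilator = measure \<mu> (\<Union>?T)"
    using measure_Union_cosets[of ?T] by simp
  also have "\<Union>?T \<subseteq> brace_centralizer a"
    using b(1) zero_in_annihilator annihilator_coset_subset_centralizer[of b a]
    by (auto simp: annihilator_eq)
  then have "measure \<mu> (\<Union>?T) \<le> measure \<mu> (brace_centralizer a)"
    using closed_centralizer[of a] by (intro haar.finite_measure_mono) (auto simp: sets_haar)
  also have "\<dots> \<le> 1 / 2"
    using a by (intro centralizer_le_half) (simp add: annihilator_iff)
  finally have "measure \<mu> annihilator \<le> 1 / 4" by simp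
  moreover have "1 \<le> 3 * measure \<mu> annihilator"
    using index_times_measure[OF fin] card
    by (metis measure_nonneg mult_right_mono of_nat_le_iff of_nat_numeral)
  ultimately show False by simp
qed

lemma commuting_probability_small_index:
  assumes fin: "finite (annihilator_quotient :: 'a set set)"
    and card: "card (annihilator_quotient :: 'a set set) \<le> 3"
  shows "commuting_probability P =
    measure \<mu> annihilator + (1 - measure \<mu> annihilator) * measure \<mu> annihilator"
proof -
  let ?A = "annihilator :: 'a set"
  have A: "?A \<in> sets borel" by (rule borel_closed[OF closed_annihilator])
  have "commuting_pairs = ?A \<times> UNIV \<union> (- ?A) \<times> ?A"
    using centralizer_eq_annihilator[OF fin card] annihilator_iff
    unfolding commuting_pairs_eq by blast
  moreover have "measure P (?A \<times> UNIV \<union> (- ?A) \<times> ?A) = measure P (?A \<times> UNIV) + measure P ((- ?A) \<times> ?A)"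
    using A by (intro product.finite_measure_Union) (auto simp: sets_product intro!: borel_Times)
  moreover have "measure P (B \<times> C) = measure \<mu> B * measure \<mu> C"
    if "B \<in> sets borel" "C \<in> sets borel" for B C
    using product_rectangle[OF that] by (simp add: measure_def enn2real_mult)
  moreover have "measure \<mu> (- ?A) = 1 - measure \<mu> ?A"
    using haar.prob_compl[of ?A] A by (simp add: sets_haar space_haar Compl_eq_Diff_UNIV)
  ultimately show ?thesis
    using A haar.prob_space by (simp add: commuting_probability_def space_haar)
qed

text \<open>
  The strip estimate needs a closed base, and the complement of the annihilator is only open.
  So the annihilator is first enlarged to an open set of nearly the same measure.
\<close>

lemma commuting_probability_le:
  "commuting_probability P \<le> 1 / 2 + measure \<mu> annihilator / 2"
proof (rule field_le_epsilon)
  let ?A = "annihilator :: 'a set" and ?Z = "commuting_pairs :: ('a \<times> 'a) set"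
  fix e :: real assume e: "0 < e"
  have "emeasure \<mu> ?A < ennreal (measure \<mu> ?A + e)"
    using e by (simp add: haar.emeasure_eq_measure ennreal_less_iff)
  moreover have "?A \<in> sets borel"
    by (rule borel_closed[OF closed_annihilator])
  ultimately have "(INF U\<in>{U. open U \<and> ?A \<subseteq> U}. emeasure \<mu> U) < ennreal (measure \<mu> ?A + e)"
    using haar_outer by metis
  then obtain U where U: "open U" "?A \<subseteq> U" "measure \<mu> U < measure \<mu> ?A + e"
    by (auto simp: INF_less_iff haar.emeasure_eq_measure ennreal_less_iff)
  have half_nonneg: "0 \<le> (1 / 2 :: real)"
    by simp
  have half: "ennreal (1 / 2) < \<infinity>"
    by (simp only: infinity_ennreal_def ennreal_less_top)
  have "emeasure P (?Z \<inter> (- U) \<times> UNIV) \<le> ennreal (1 / 2) * emeasure \<mu> (- U)"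
  proof (rule product_strip_le[OF closed_commuting_pairs _ _ half])
    fix a assume "a \<in> - U"
    then have "brace_centralizer a \<noteq> UNIV"
      using U(2) annihilator_iff by blast
    then show "emeasure \<mu> (Pair a -` ?Z) \<le> ennreal (1 / 2)"
      unfolding haar.emeasure_eq_measure centralizer_eq_slice[symmetric]
      by (intro ennreal_leI centralizer_le_half)
  qed (use U(1) in \<open>auto\<close>)
  then have 1: "measure P (?Z \<inter> (- U) \<times> UNIV) \<le> measure \<mu> (- U) / 2"
    unfolding haar.emeasure_eq_measure product.emeasure_eq_measure
      ennreal_mult[OF half_nonneg measure_nonneg, symmetric] by simp
  have Z_borel: "?Z \<in> sets borel"
    by (rule borel_closed[OF closed_commuting_pairs])
  have "measure P ?Z \<le> measure P (U \<times> UNIV \<union> ?Z \<inter> (- U) \<times> UNIV)"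
    using U(1) Z_borel
    by (intro product.finite_measure_mono)
      (auto simp: sets_product intro!: borel_Times sets.Un sets.Int)
  also have "\<dots> \<le> measure P (U \<times> UNIV) + measure P (?Z \<inter> (- U) \<times> UNIV)"
    using U(1) Z_borel
    by (intro measure_Un_le)
      (auto simp: sets_product intro!: borel_Times sets.Int)
  also have "measure P (U \<times> UNIV) = measure \<mu> U"
    using product_rectangle[of U UNIV] U(1) haar.emeasure_space_1
    by (simp add: measure_def space_haar)
  also have "measure \<mu> U + measure P (?Z \<inter> (- U) \<times> UNIV) \<le> measure \<mu> U + measure \<mu> (- U) / 2"
    using 1 by simp
  also have "measure \<mu> (- U) = 1 - measure \<mu> U"
    using haar.prob_compl[of U] U(1) by (simp add: sets_haar space_haar Compl_eq_Diff_UNIV)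
  finally show "commuting_probability P \<le> 1 / 2 + measure \<mu> ?A / 2 + e"
    using U(3) e by (simp add: commuting_probability_def field_simps)
qed

lemma commuting_probability_large_index:
  assumes large: "\<not> (finite (annihilator_quotient :: 'a set set) \<and>
    card (annihilator_quotient :: 'a set set) \<le> 3)"
  shows "commuting_probability P \<le> 5 / 8"
proof -
  obtain \<T> where \<T>: "\<T> \<subseteq> (annihilator_quotient :: 'a set set)" "finite \<T>" "card \<T> = 4"
  proof (cases "finite (annihilator_quotient :: 'a set set)")
    case True
    with large have "4 \<le> card (annihilator_quotient :: 'a set set)" by simp
    then show ?thesis using that obtain_subset_with_card_n by metis
  next
    case False
    then show ?thesis using that infinite_arbitrarily_large by metis
  qed
  then have "4 * measure \<mu> annihilator = measure \<mu> (\<Union>\<T>)"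
    using measure_Union_cosets by simp
  also have "\<dots> \<le> 1" by simp
  finally show ?thesis
    using commuting_probability_le by simp
qed

end

theorem theorem5p13:
  fixes \<mu> :: "'a::compact_skew_left_brace measure"
    and P :: "('a \<times> 'a) measure"
  assumes "haar_probability \<mu>"
    and "is_radon_product \<mu> \<mu> P"
  shows "(commuting_probability P > 5 / 8 \<longleftrightarrow>
           finite (annihilator_quotient :: 'a set set) \<and>
           card (annihilator_quotient :: 'a set set) \<le> 2) \<and>
         (card (annihilator_quotient :: 'a set set) = 2 \<longleftrightarrow> commuting_probability P = 3 / 4)"
proof -
  interpret compact_brace_haar \<mu> P
    by unfold_locales (use assms compact_UNIV_brace in auto)
  let ?Q = "annihilator_quotient :: 'a set set"
  show ?thesis
  proof (cases "finite ?Q \<and> card ?Q \<le> 3")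
    case False
    then have "commuting_probability P \<le> 5 / 8"
      by (rule commuting_probability_large_index)
    \<comment> \<open>An infinite quotient has cardinality \<open>0\<close> here, so \<open>card ?Q = 2\<close> forces finiteness.\<close>
    moreover have "\<not> (finite ?Q \<and> card ?Q \<le> 2)" "card ?Q \<noteq> 2"
      using False card_ge_0_finite[of ?Q] by auto
    ultimately show ?thesis by auto
  next
    case True
    let ?m = "measure \<mu> (annihilator :: 'a set)"
    have m: "card ?Q * ?m = 1"
      using True index_times_measure by blast
    then have "card ?Q \<noteq> 0"
      by (metis mult_zero_left of_nat_0 zero_neq_one)
    then consider "card ?Q = 1" | "card ?Q = 2" | "card ?Q = 3"
      using True by linarith
    then show ?thesis
    proof cases
      case 1
      with m have "?m = 1" by simp
      with 1 True commuting_probability_small_index show ?thesis by simp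
    next
      case 2
      with m have "?m = 1 / 2" by simp
      with 2 True commuting_probability_small_index show ?thesis by simp
    next
      case 3
      with m have "?m = 1 / 3" by simp
      with 3 True commuting_probability_small_index show ?thesis by simp
    qed
  qed
qed

end
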